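(* For all integers $n,k\ge 2$ with $2n-3\ge 0$, the binomial Ward-Lah numbers $B(n,k)$ satisfy $$\begin{aligned}B(n,k)=\;&\frac{-4(n-2)(2n-1)^2}{n}\Big(B(n-2,k-2)-2\,B(n-2,k-1)+B(n-2,k)\Big)\\&+\frac{4(2n-1)}{n(2n-3)}\Big(\big(2(n-1)^2-1\big)B(n-1,k-1)+2(n-1)^2\,B(n-1,k)\Big).\end{aligned}$$
   Context: Partition transformation: for integers $n,k\ge 0$ and a sequence $a_1,a_2,\dots$, $$P_n^k(a_1,a_2,\dots)=\sum_{q}(-1)^{q_0}\prod_{j=0}^{\ell(q)-1}\binom{q_j}{q_{j+1}}a_{j+1}^{q_j},$$ where the sum is over integer partitions $q=(q_0\ge q_1\ge\dots)$ of $n=q_0+q_1+\cdots$ with $q_0=k$; $\ell(q)$ is the length of $q$ (number of positive parts), so $q_{\ell(q)-1}>0$ and $q_{\ell(q)}=0$. Binomial Ward-Lah numbers: for integers $n\ge k\ge 0$, $B(n,k)=(-1)^k \dfrac{(2n)!}{k!(n-k)!}\,P_n^k(1,1,\dots)$ (all $a_i=1$), with $B(0,0)=1$, $B(n,0)=0$ for $n\ge 1$, $B(0,k)=0$ for $k\ge 1$, and $B(n,k)=0$ for $k>n$. *)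

theory Defs
  imports Complex_Main
begin

text \<open>A partition \<open>q\<^sub>0 \<ge> q\<^sub>1 \<ge> \<dots>\<close> is represented as the infinite sequence of its parts,
  padded with zeros, so \<open>q j\<close> is 0 from the length of the partition onwards.\<close>

definition part_length :: "(nat \<Rightarrow> nat) \<Rightarrow> nat" where
  "part_length q = card {j. 0 < q j}"

definition int_partitions :: "nat \<Rightarrow> (nat \<Rightarrow> nat) set" where
  "int_partitions n =
     {q. antimono q \<and> finite {j. 0 < q j} \<and> (\<Sum>j | 0 < q j. q j) = n}"

lemma finite_int_partitions: "finite (int_partitions n)"
proof -
  let ?F = "{f. \<forall>x. (x \<in> {..n} \<longrightarrow> f x \<in> {..n}) \<and> (x \<notin> {..n} \<longrightarrow> f x = 0)}
              :: (nat \<Rightarrow> nat) set"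
  have "int_partitions n \<subseteq> ?F"
  proof
    fix q assume "q \<in> int_partitions n"
    then have anti: "antimono q" and fin: "finite {j. 0 < q j}"
      and sm: "(\<Sum>j | 0 < q j. q j) = n"
      by (auto simp: int_partitions_def)
    have le: "q j \<le> n" for j
    proof (cases "q j = 0")
      case False
      then have "q j \<le> (\<Sum>j | 0 < q j. q j)"
        by (intro member_le_sum) (use fin in auto)
      with sm show ?thesis by simp
    qed simp
    have zero: "q j = 0" if "j > n" for j
    proof (rule ccontr)
      assume "q j \<noteq> 0"
      then have "{..j} \<subseteq> {j. 0 < q j}"
        using antimonoD[OF anti] by (metis atMost_iff gr0I le_zero_eq mem_Collect_eq subsetI)
      then have "card {..j} \<le> card {j. 0 < q j}"
        using fin card_mono by blast
      moreover have "card {j. 0 < q j} \<le> (\<Sum>j | 0 < q j. q j)"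
        unfolding card_eq_sum by (rule sum_mono) auto
      ultimately show False using sm that by simp
    qed
    show "q \<in> ?F" using le zero by auto
  qed
  moreover have "finite ?F" by (rule finite_set_of_finite_funs) auto
  ultimately show ?thesis by (rule finite_subset)
qed

text \<open>The sequence \<open>a\<^sub>1, a\<^sub>2, \<dots>\<close> is a function on \<open>nat\<close> whose value at 0 is never used.\<close>

definition partition_transform ::
    "nat \<Rightarrow> nat \<Rightarrow> (nat \<Rightarrow> 'a::comm_ring_1) \<Rightarrow> 'a" where
  "partition_transform n k a =
     (\<Sum>q \<in> {q \<in> int_partitions n. q 0 = k}.
        (- 1) ^ q 0 *
        (\<Prod>j<part_length q. of_nat (q j choose q (j + 1)) * a (j + 1) ^ q j))"

definition binomial_ward_lah :: "nat \<Rightarrow> nat \<Rightarrow> real" where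
  "binomial_ward_lah n k =
     (if k \<le> n
      then (- 1) ^ k * (fact (2 * n) / (fact k * fact (n - k))) *
             partition_transform n k (\<lambda>_. 1)
      else 0)"

text \<open>The boundary values are consequences of the general formula.\<close>

lemma int_partitions_first_zero:
  "{q \<in> int_partitions n. q 0 = 0} = (if n = 0 then {\<lambda>_. 0} else {})"
proof -
  have "q = (\<lambda>_. 0)" if "antimono q" "q 0 = 0" for q :: "nat \<Rightarrow> nat"
    using antimonoD[OF that(1), of 0] that(2) by auto
  then have zero: "q = (\<lambda>_. 0)" if "q \<in> int_partitions n" "q 0 = 0" for q
    using that by (simp add: int_partitions_def)
  have mem: "(\<lambda>_. 0) \<in> int_partitions n \<longleftrightarrow> n = 0"
    by (auto simp: int_partitions_def antimono_def)
  show ?thesis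
  proof (cases "n = 0")
    case True
    then have "(\<lambda>_. 0) \<in> {q \<in> int_partitions n. q 0 = 0}" using mem by simp
    moreover have "{q \<in> int_partitions n. q 0 = 0} \<subseteq> {\<lambda>_. 0}"
      using zero by blast
    ultimately show ?thesis using True by force
  next
    case False
    have "q 0 \<noteq> 0" if "q \<in> int_partitions n" for q
      using zero[OF that] mem that False by metis
    then show ?thesis using False by simp
  qed
qed

lemma binomial_ward_lah_0_0: "binomial_ward_lah 0 0 = 1"
proof -
  have "partition_transform 0 0 (\<lambda>_. 1 :: real) = 1"
    unfolding partition_transform_def int_partitions_first_zero
    by (simp add: part_length_def)
  then show ?thesis by (simp add: binomial_ward_lah_def)
qed

lemma binomial_ward_lah_n_0: "n \<ge> 1 \<Longrightarrow> binomial_ward_lah n 0 = 0"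
  unfolding binomial_ward_lah_def partition_transform_def int_partitions_first_zero by simp

lemma binomial_ward_lah_gt: "k > n \<Longrightarrow> binomial_ward_lah n k = 0"
  by (simp add: binomial_ward_lah_def)

end

theory Submission
  imports Defs
begin

text \<open>Removing the first part of a partition gives a recurrence for \<open>P\<^sub>n\<^sup>k\<close>. For \<open>a = 1\<close> it says that
  the generating functions \<open>G\<^sub>k(x) = \<Sum>\<^sub>n (-1)\<^sup>k P\<^sub>n\<^sup>k(1,1,\<dots>) x\<^sup>n\<close> satisfy
  \<open>G\<^sub>k = x\<^sup>k \<Sum>\<^sub>j (k choose j) G\<^sub>j\<close>, which \<open>G\<^sub>k = (x/(1-x))\<^sup>k\<close> solves. Hence
  \<open>(-1)\<^sup>k P\<^sub>n\<^sup>k(1,1,\<dots>) = (n-1 choose k-1)\<close>, and all terms of the claimed identity are polynomial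
  multiples of the same quotient of factorials.\<close>

section \<open>Prepending a part to a partition\<close>

lemma support_case_nat:
  fixes q :: "nat \<Rightarrow> nat"
  shows "{j. 0 < case_nat k q j} = (if k > 0 then {0} else {}) \<union> Suc ` {j. 0 < q j}"
proof (rule set_eqI)
  show "j \<in> {j. 0 < case_nat k q j} \<longleftrightarrow>
      j \<in> (if k > 0 then {0} else {}) \<union> Suc ` {j. 0 < q j}" for j
    by (cases j) auto
qed

lemma part_length_case_nat:
  assumes "finite {j. 0 < q j}" "k > 0"
  shows "part_length (case_nat k q) = Suc (part_length q)"
  using assms by (simp add: part_length_def support_case_nat card_image)

lemma antimono_case_nat:
  fixes q :: "nat \<Rightarrow> nat"
  shows "antimono (case_nat k q) \<longleftrightarrow> q 0 \<le> k \<and> antimono q"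
  by (auto simp: antimono_iff_le_Suc split: nat.splits)

lemma finite_support_case_nat:
  fixes q :: "nat \<Rightarrow> nat"
  shows "finite {j. 0 < case_nat k q j} \<longleftrightarrow> finite {j. 0 < q j}"
  by (simp add: support_case_nat finite_image_iff)

lemma sum_support_case_nat:
  fixes q :: "nat \<Rightarrow> nat"
  assumes "finite {j. 0 < q j}"
  shows "(\<Sum>j | 0 < case_nat k q j. case_nat k q j) = k + (\<Sum>j | 0 < q j. q j)"
  using assms by (auto simp: support_case_nat sum.reindex)

text \<open>The bound \<open>k \<le> n\<close> is explicit because \<open>n - k\<close> truncates:
  for \<open>k > n\<close> the zero sequence would satisfy the other two conditions.\<close>

lemma case_nat_in_int_partitions:
  "case_nat k q \<in> int_partitions n \<longleftrightarrow> k \<le> n \<and> q 0 \<le> k \<and> q \<in> int_partitions (n - k)"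
  by (auto simp: int_partitions_def antimono_case_nat finite_support_case_nat sum_support_case_nat)

text \<open>The remainders are grouped by their own first part \<open>j\<close>, the index under
  which the transform of the remainder sums them.\<close>

lemma int_partitions_first_part:
  "{q \<in> int_partitions n. q 0 = k} =
     (if k \<le> n then case_nat k ` (\<Union>j\<le>k. {q \<in> int_partitions (n - k). q 0 = j}) else {})"
proof -
  have "q = case_nat (q 0) (\<lambda>j. q (Suc j))" for q :: "nat \<Rightarrow> nat"
    by (auto simp: fun_eq_iff split: nat.splits)
  then have "{q \<in> int_partitions n. q 0 = k} =
      case_nat k ` {q. case_nat k q \<in> int_partitions n}"
    by (auto simp: image_iff) metis
  then show ?thesis
    unfolding case_nat_in_int_partitions by auto
qed

text \<open>The factor of the product at index 0 is \<open>(k choose j) * a 1 ^ k\<close>, where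
  \<open>j\<close> is the second part; the other factors are those of the remainder for the shifted
  sequence. The sign \<open>(- 1) ^ j\<close> cancels the one inside the transform of the remainder.
  Positivity of \<open>k\<close> makes the length grow by exactly one.\<close>

lemma partition_transform_rec:
  assumes "0 < k" "k \<le> n"
  shows "partition_transform n k a =
    (- a 1) ^ k * (\<Sum>j\<le>k. (- 1) ^ j * of_nat (k choose j) *
       partition_transform (n - k) j (\<lambda>i. a (Suc i)))"
proof -
  let ?Q = "\<lambda>j. {q \<in> int_partitions (n - k). q 0 = j}"
  let ?t = "\<lambda>a q. (- 1) ^ q 0 *
        (\<Prod>j<part_length q. of_nat (q j choose q (j + 1)) * a (j + 1) ^ q j)"
  have inj: "inj_on (case_nat k) A" for A :: "(nat \<Rightarrow> nat) set"
    by (auto simp: inj_on_def fun_eq_iff split: nat.splits)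
  have step: "?t a (case_nat k q) =
      (- a 1) ^ k * ((- 1) ^ j * of_nat (k choose j) * ?t (\<lambda>i. a (Suc i)) q)"
    if "q \<in> ?Q j" for q j
  proof -
    have "finite {j. 0 < q j}" "q 0 = j" using that by (auto simp: int_partitions_def)
    then have "?t a (case_nat k q) = (- 1) ^ k * (of_nat (k choose j) * a 1 ^ k *
        (\<Prod>j<part_length q. of_nat (q j choose q (j + 1)) * a (Suc (j + 1)) ^ q j))"
      using assms(1) by (simp add: part_length_case_nat prod.lessThan_Suc_shift del: prod.lessThan_Suc)
    moreover have "(- a 1) ^ k = (- 1) ^ k * a 1 ^ k" by (rule power_minus)
    moreover have "(- 1) ^ j * (- 1) ^ j = (1 :: 'a)"
      by (simp flip: power_mult_distrib)
    ultimately show ?thesis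
      using \<open>q 0 = j\<close> by (simp add: algebra_simps)
  qed
  have "partition_transform n k a = sum (?t a) (case_nat k ` (\<Union>j\<le>k. ?Q j))"
    unfolding partition_transform_def int_partitions_first_part[of n k] using assms(2) by simp
  also have "\<dots> = (\<Sum>q\<in>(\<Union>j\<le>k. ?Q j). ?t a (case_nat k q))"
    by (simp add: sum.reindex[OF inj])
  also have "\<dots> = (\<Sum>j\<le>k. \<Sum>q\<in>?Q j. ?t a (case_nat k q))"
    by (rule sum.UNION_disjoint) (auto simp: finite_int_partitions)
  also have "\<dots> = (\<Sum>j\<le>k. \<Sum>q\<in>?Q j. (- a 1) ^ k *
      ((- 1) ^ j * of_nat (k choose j) * ?t (\<lambda>i. a (Suc i)) q))"
    using step by (intro sum.cong refl) blast
  also have "\<dots> = (- a 1) ^ k * (\<Sum>j\<le>k. (- 1) ^ j * of_nat (k choose j) *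
       partition_transform (n - k) j (\<lambda>i. a (Suc i)))"
    unfolding partition_transform_def by (simp add: sum_distrib_left)
  finally show ?thesis .
qed

section \<open>Closed forms at the all-ones sequence\<close>

lemma partition_transform_0_right:
  "partition_transform n 0 a = (if n = 0 then 1 else 0)"
  unfolding partition_transform_def int_partitions_first_zero by (simp add: part_length_def)

lemma partition_transform_gt: "k > n \<Longrightarrow> partition_transform n k a = 0"
  unfolding partition_transform_def int_partitions_first_part[of n k] by simp

text \<open>By strong induction on \<open>n\<close>: inserting the closed form into the recurrence
  turns its right-hand side into a Vandermonde convolution.\<close>

lemma partition_transform_one:
  "partition_transform (Suc n) (Suc k) (\<lambda>_. 1 :: 'a :: comm_ring_1) =
     (- 1) ^ Suc k * of_nat (n choose k)"
proof (induction n arbitrary: k rule: less_induct)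
  case (less n)
  let ?P = "\<lambda>n k. partition_transform n k (\<lambda>_. 1 :: 'a)"
  consider "k > n" | "k = n" | "k < n" by linarith
  then show ?case
  proof cases
    case 1
    then show ?thesis by (simp add: partition_transform_gt binomial_eq_0)
  next
    case 2
    \<comment> \<open>Nothing remains after the first part, so only \<open>j = 0\<close>
      contributes, with value 1.\<close>
    have "?P (Suc n) (Suc n) =
        (- 1) ^ Suc n * (\<Sum>j\<le>Suc n. (- 1) ^ j * of_nat (Suc n choose j) * ?P 0 j)"
      by (subst partition_transform_rec) simp_all
    also have "(\<Sum>j\<le>Suc n. (- 1) ^ j * of_nat (Suc n choose j) * ?P 0 j) = 1"
      by (simp only: sum.atMost_Suc_shift)
        (simp add: partition_transform_gt partition_transform_0_right)
    finally show ?thesis using 2 by simp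
  next
    case 3
    \<comment> \<open>The remainder then has the positive size \<open>Suc m\<close>, so the term
      \<open>j = 0\<close> drops out and the sum can be shifted.\<close>
    then obtain m where m: "n = Suc (k + m)" using less_iff_Suc_add by auto
    have "(\<Sum>j\<le>Suc k. (- 1) ^ j * of_nat (Suc k choose j) * ?P (Suc m) j) =
        (\<Sum>j\<le>k. (- 1) ^ Suc j * of_nat (Suc k choose Suc j) * ?P (Suc m) (Suc j))"
      by (simp only: sum.atMost_Suc_shift) (simp add: partition_transform_0_right)
    also have "\<dots> = (\<Sum>j\<le>k. of_nat ((Suc k choose (k - j)) * (m choose j)))"
    proof (rule sum.cong)
      fix j assume "j \<in> {..k}"
      \<comment> \<open>Passing to the complement makes the lower indices \<open>k - j\<close> and
        \<open>j\<close> add up to \<open>k\<close>, as Vandermonde requires.\<close>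
      then have "Suc k choose Suc j = Suc k choose (k - j)"
        by (subst binomial_symmetric) simp_all
      moreover have "(- 1) ^ Suc j * (- 1) ^ Suc j = (1 :: 'a)"
        by (simp flip: power_mult_distrib)
      moreover have "?P (Suc m) (Suc j) = (- 1) ^ Suc j * of_nat (m choose j)"
        by (rule less.IH) (simp add: m)
      ultimately show "(- 1) ^ Suc j * of_nat (Suc k choose Suc j) * ?P (Suc m) (Suc j) =
          of_nat ((Suc k choose (k - j)) * (m choose j))"
        by (simp add: algebra_simps)
    qed simp
    also have "\<dots> = of_nat (n choose k)"
      using vandermonde[of m "Suc k" k] by (simp add: m mult.commute add.commute flip: of_nat_sum of_nat_mult)
    finally show ?thesis
      using 3 by (subst partition_transform_rec) (simp_all add: m)
  qed
qed

text \<open>The signs cancel, and the \<open>fact (n - k)\<close> in the denominator of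
  \<open>n choose k\<close> meets the one in the definition, hence the square.\<close>

lemma binomial_ward_lah_Suc:
  "binomial_ward_lah (Suc n) (Suc k) =
     (if k \<le> n then fact (2 * Suc n) * fact n / (fact (Suc k) * fact k * (fact (n - k))\<^sup>2) else 0)"
proof (cases "k \<le> n")
  case True
  then show ?thesis
    unfolding binomial_ward_lah_def partition_transform_one
    by (cases "even k")
      (simp_all add: binomial_fact power2_eq_square mult_ac del: fact_Suc mult_Suc_right)
qed (simp add: binomial_ward_lah_def)

section \<open>Reduction of the recurrence to a polynomial identity\<close>

theorem theorem6p8:
  fixes n k :: nat
  assumes "n \<ge> 2" and "k \<ge> 2" and "2 * int n - 3 \<ge> 0"
  shows "binomial_ward_lah n k =
      (- 4 * (real n - 2) * (2 * real n - 1)\<^sup>2) / real n *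
        (binomial_ward_lah (n - 2) (k - 2) - 2 * binomial_ward_lah (n - 2) (k - 1)
          + binomial_ward_lah (n - 2) k)
    + (4 * (2 * real n - 1)) / (real n * (2 * real n - 3)) *
        ((2 * (real n - 1)\<^sup>2 - 1) * binomial_ward_lah (n - 1) (k - 1)
          + 2 * (real n - 1)\<^sup>2 * binomial_ward_lah (n - 1) k)"
proof -
  let ?B = binomial_ward_lah
  obtain l where k: "k = Suc (Suc l)" using assms(2) by (intro that[of "k - 2"]) simp
  \<comment> \<open>For \<open>k > n\<close> all six values vanish. The pair (2, 2) is separate
    because it involves \<open>?B 0 0\<close>, which the closed form at successors does not cover;
    there the factor \<open>n - 2\<close> kills the first bracket.\<close>
  consider "k > n" | "n = 2" "k = 2" | "n \<ge> 3" "k \<le> n" using assms by linarith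
  then show ?thesis
  proof cases
    case 1
    then show ?thesis using assms by (simp add: binomial_ward_lah_gt)
  next
    case 2
    have "?B 2 2 = 12" "?B 1 1 = 2"
      using binomial_ward_lah_Suc[of 1 1] binomial_ward_lah_Suc[of 0 0]
      by (simp_all add: numeral_2_eq_2 fact_numeral)
    then show ?thesis using 2 by (simp add: binomial_ward_lah_gt)
  next
    case 3
    obtain p where n: "n = Suc (Suc (Suc p))"
      using 3(1) by (intro that[of "n - 3"]) simp
    \<comment> \<open>Here \<open>d\<close> is \<open>n - k\<close>.\<close>
    obtain d where d: "Suc p = l + d" using 3(2) n k by (auto simp: le_iff_add)
    define N L D :: real where "N = real p" and "L = real l" and "D = real d"
    have N: "N = L + D - 1" and "N \<ge> 0"
      using arg_cong[OF d, of real] by (simp_all add: N_def L_def D_def)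
    \<comment> \<open>\<open>T\<close> pairs the numerator of the values at \<open>n - 2\<close>
      with the denominator of \<open>?B n k\<close>, whose factorials are the largest among the six
      terms. Each term is therefore \<open>T\<close> times a polynomial in \<open>N\<close>,
      \<open>L\<close>, \<open>D\<close>.\<close>
    define T :: real where
      "T = fact (2 * Suc p) * fact p / (fact (l + 2) * fact (l + 1) * (fact d)\<^sup>2)"
    \<comment> \<open>In this and the following evaluations, the degenerate cases
      (\<open>l = 0\<close>, \<open>d = 0\<close> or \<open>d < 2\<close>) are those in which the
      value is 0 and the polynomial vanishes as well.\<close>
    have B1: "?B (n - 2) (k - 2) = T * ((L + 2) * (L + 1)\<^sup>2 * L)"
    proof (cases l)
      case 0
      then show ?thesis by (simp add: n k L_def binomial_ward_lah_n_0)
    next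
      case (Suc i)
      then have "p - i = d" "i \<le> p" using d by auto
      moreover have "fact (l + 2) * fact (l + 1) =
          (L + 2) * (L + 1)\<^sup>2 * L * (fact (Suc i) * fact i :: real)"
        by (simp add: Suc L_def power2_eq_square algebra_simps)
      moreover have "L > 0" by (simp add: L_def Suc)
      ultimately show ?thesis
        by (simp add: n k Suc T_def binomial_ward_lah_Suc[of p i] del: fact_Suc mult_Suc_right)
    qed
    have B2: "?B (n - 2) (k - 1) = T * ((L + 2) * (L + 1) * D\<^sup>2)"
    proof (cases d)
      case 0
      then show ?thesis using d by (simp add: n k D_def binomial_ward_lah_gt)
    next
      case (Suc i)
      then have "p - l = i" "l \<le> p" using d by auto
      moreover have "fact (l + 2) * fact (l + 1) =
          (L + 2) * (L + 1) * (fact (Suc l) * fact l :: real)"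
        by (simp add: L_def algebra_simps)
      moreover have "fact d = D * (fact i :: real)" by (simp add: Suc D_def)
      moreover have "D > 0" "L \<ge> 0" by (simp_all add: D_def L_def Suc)
      ultimately show ?thesis
        by (simp add: n k T_def binomial_ward_lah_Suc[of p l] power_mult_distrib
              del: fact_Suc mult_Suc_right)
    qed
    have B3: "?B (n - 2) k = T * (D * (D - 1))\<^sup>2"
    proof (cases "d < 2")
      case True
      then have "d = 0 \<or> d = 1" by auto
      then show ?thesis using d by (auto simp: n k D_def binomial_ward_lah_gt)
    next
      case False
      then obtain i where i: "d = Suc (Suc i)"
        by (intro that[of "d - 2"]) simp
      then have "p - Suc l = i" "Suc l \<le> p" using d by auto
      moreover have "fact d = D * (D - 1) * (fact i :: real)" by (simp add: i D_def)
      moreover have "D > 0" "D - 1 > 0" by (simp_all add: D_def i)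
      ultimately show ?thesis
        by (simp add: n k T_def binomial_ward_lah_Suc[of p "Suc l"] power_mult_distrib
              del: fact_Suc mult_Suc_right)
    qed
    have fact1: "fact (2 * Suc (Suc p)) * fact (Suc p) =
        (2 * N + 4) * (2 * N + 3) * (N + 1) * (fact (2 * Suc p) * fact p :: real)"
      by (simp add: N_def algebra_simps)
    have B4: "?B (n - 1) (k - 1) = T * ((2 * N + 4) * (2 * N + 3) * (N + 1) * ((L + 2) * (L + 1)))"
    proof -
      have "Suc p - l = d" "l \<le> Suc p" using d by auto
      moreover have "fact (l + 2) * fact (l + 1) =
          (L + 2) * (L + 1) * (fact (Suc l) * fact l :: real)"
        by (simp add: L_def algebra_simps)
      moreover have "L \<ge> 0" by (simp add: L_def)
      ultimately show ?thesis
        by (simp add: n k T_def binomial_ward_lah_Suc[of "Suc p" l] fact1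
              del: fact_Suc mult_Suc_right) (simp only: mult_ac)
    qed
    have B5: "?B (n - 1) k = T * ((2 * N + 4) * (2 * N + 3) * (N + 1) * D\<^sup>2)"
    proof (cases d)
      case 0
      then show ?thesis using d by (simp add: n k D_def binomial_ward_lah_gt)
    next
      case (Suc i)
      then have "p - l = i" "l \<le> p" using d by auto
      moreover have "fact d = D * (fact i :: real)" by (simp add: Suc D_def)
      moreover have "D > 0" by (simp add: D_def Suc)
      ultimately show ?thesis
        by (simp add: n k T_def binomial_ward_lah_Suc[of "Suc p" "Suc l"] fact1 power_mult_distrib
              del: fact_Suc mult_Suc_right) (simp only: mult_ac)
    qed
    have B6: "?B n k = T * ((2 * N + 6) * (2 * N + 5) * (2 * N + 4) * (2 * N + 3) * (N + 2) * (N + 1))"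
    proof -
      have "Suc p - l = d" "l \<le> Suc p" using d by auto
      moreover have "fact (2 * Suc (Suc (Suc p))) * fact (Suc (Suc p)) =
          (2 * N + 6) * (2 * N + 5) * (N + 2) * (fact (2 * Suc (Suc p)) * fact (Suc p) :: real)"
        by (simp add: N_def algebra_simps)
      ultimately show ?thesis
        by (simp add: n k T_def binomial_ward_lah_Suc[of "Suc (Suc p)" "Suc l"] fact1
              del: fact_Suc mult_Suc_right)
    qed
    have rn: "real n = N + 3" by (simp add: n N_def)
    define u v w where "u = (L + 2) * (L + 1)\<^sup>2 * L - 2 * ((L + 2) * (L + 1) * D\<^sup>2) + (D * (D - 1))\<^sup>2"
      and "v = (L + 2) * (L + 1)" and "w = D\<^sup>2"
    \<comment> \<open>This is the claim divided by \<open>T\<close>, with denominators cleared and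
      the common factor \<open>?M\<close> below cancelled. Substituting \<open>N = L + D - 1\<close>
      leaves an identity in the independent variables \<open>L\<close> and \<open>D\<close>.\<close>
    have core: "(N + 3)\<^sup>2 * (N + 2)\<^sup>2 * (2 * N + 3) =
        - (2 * N + 5) * u + (2 * N + 4) * ((2 * (N + 2)\<^sup>2 - 1) * v + 2 * (N + 2)\<^sup>2 * w)"
      unfolding N u_def v_def w_def by (simp add: power2_eq_square) (simp add: algebra_simps)
    let ?l = "(2 * N + 6) * (2 * N + 5) * (2 * N + 4) * (2 * N + 3) * (N + 2) * (N + 1)"
    let ?x = "N + 3" and ?y = "2 * N + 3" and ?M = "4 * (N + 1) * (2 * N + 5) * (2 * N + 3)"
    let ?a = "- 4 * (N + 1) * (2 * N + 5)\<^sup>2" and ?b = "4 * (2 * N + 5)"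
    let ?c = "(2 * (N + 2)\<^sup>2 - 1) * ((2 * N + 4) * (2 * N + 3) * (N + 1) * v)
      + 2 * (N + 2)\<^sup>2 * ((2 * N + 4) * (2 * N + 3) * (N + 1) * w)"
    have x: "?x \<noteq> 0" and y: "?y \<noteq> 0" using \<open>N \<ge> 0\<close> by linarith+
    \<comment> \<open>Multiplying \<open>core\<close> by \<open>?M\<close> restores the coefficients
      of the claim; dividing by \<open>?x * ?y\<close>, which is \<open>n * (2 * n - 3)\<close>,
      restores its fractions.\<close>
    have "?l * (?x * ?y) = ?M * ((N + 3)\<^sup>2 * (N + 2)\<^sup>2 * (2 * N + 3))"
      by (simp add: power2_eq_square) (simp add: algebra_simps)
    also have "\<dots> = ?a * ?y * u + ?b * ?c"
      unfolding core by (simp add: power2_eq_square) (simp add: algebra_simps)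
    finally have "?l = (?a * ?y * u + ?b * ?c) / (?x * ?y)"
      using x y by (metis nonzero_eq_divide_eq mult_eq_0_iff)
    also have "\<dots> = ?a * ?y * u / (?x * ?y) + ?b * ?c / (?x * ?y)"
      by (rule add_divide_distrib)
    also have "?a * ?y * u / (?x * ?y) = ?a / ?x * u"
      using y by (simp only: mult.commute[of _ ?y] mult.assoc mult_divide_mult_cancel_left
          times_divide_eq_left mult.left_commute[of _ ?y]) simp
    also have "?b * ?c / (?x * ?y) = ?b / (?x * ?y) * ?c"
      by (simp only: times_divide_eq_left)
    finally have "T * ?l = T * (?a / ?x * u + ?b / (?x * ?y) * ?c)"
      by (rule arg_cong)
    \<comment> \<open>These rules pull \<open>T\<close> out of the two brackets of the claim, so
      that it matches the scaled identity syntactically.\<close>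
    moreover have "T * x - 2 * (T * y) + T * z = T * (x - 2 * y + z)"
      and "x * (T * y) + z * (T * w) = T * (x * y + z * w)" for x y z w
      by (simp_all add: algebra_simps)
    moreover have "N + 3 - 1 = N + 2" "N + 3 - 2 = N + 1"
      "2 * (N + 3) - 1 = 2 * N + 5" "2 * (N + 3) - 3 = 2 * N + 3" by simp_all
    ultimately show ?thesis
      unfolding B1 B2 B3 B4 B5 B6 rn u_def v_def w_def by (simp only:)
  qed
qed

end
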